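(* The numbers $a_t^C(C_n)$ of time-dependent assembly trees satisfying the connected gluing rule for the cycle graphs $C_n$ satisfy $a^C_t(C_1)=a^C_t(C_2)=1$ and, for every integer $n\ge 3$, $$a^C_t(C_n)=1+\sum_{j=2}^{n-1}\binom{n}{j}a^C_t(C_j).$$
   Context: All graphs are finite and simple. Let $G=(V,E)$ be a connected graph with $|V|=N\ge 2$. A time-dependent assembly tree for $G$ is a rooted (unordered) tree each of whose nodes is labeled by a pair $(U,i)$ with $U\subseteq V$ and $i$ a nonnegative integer, such that: (1) the leaves are exactly $N$ in number, labeled $(v,0)$, one for each vertex $v\in V$ ($v$ identified with $\{v\}$); (2) each internal (non-leaf) node has at least two children; (3) the root is labeled $(V,m)$ for some $1\le m\le N-1$; (4) for each internal node $(U,i)$, $U$ is the union of the vertex sets labeling its children (equivalently, the set of leaves below it); (5) if $(U,i)$ and $(U',i')$ are adjacent nodes with $U\subseteq U'$, then $i<i'$; (6) for each $0\le i\le m$ there exists a node labeled $(U,i)$ for some $U\subseteq V$. For $N=1$, by convention the only time-dependent assembly tree is the single node $(v,0)$. Two such trees are the same if there is a label-preserving isomorphism of rooted trees between them. Such a tree satisfies the connected gluing rule if for each internal node $(U,i)$ the subgraph of $G$ induced by $U$ is connected. $a_t^C(G)$ is the number of time-dependent assembly trees for $G$ satisfying the connected gluing rule. $C_n$ is the cycle graph on vertices $1,\dots,n$ (in cyclic order) for $n\ge 3$; by convention $C_1$ is a single vertex and $C_2$ is a single edge on two vertices. *)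

theory Defs
  imports "HOL-Library.Multiset" "Graph_Theory.Graph_Theory"
begin

text \<open>
  Graphs are those of \<open>Graph_Theory\<close>: a finite simple graph is a \<^locale>\<open>pair_graph\<close>, in which an
  edge \<open>{u, v}\<close> is the pair of arcs \<open>(u, v)\<close>, \<open>(v, u)\<close>.

  In a value of the following type the children of a node form a multiset, so they are unordered,
  and two values are equal iff there is a label-preserving isomorphism of rooted trees between
  them. Hence \<open>=\<close> is the identification of trees that is used for counting. The label of a node
  is the pair \<open>(vset, time)\<close>.
\<close>

datatype 'a ltree = Node (vset: "'a set") (time: nat) (children: "'a ltree multiset")

text \<open>
  A node of a tree is represented by the subtree below it. Since distinct nodes can carry equal
  subtrees in a general tree, the nodes form a multiset.
\<close>

primrec nodes :: "'a ltree \<Rightarrow> 'a ltree multiset" where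
  "nodes (Node U i ts) = add_mset (Node U i ts) (\<Sum>\<^sub># (image_mset nodes ts))"

definition is_leaf :: "'a ltree \<Rightarrow> bool" where
  "is_leaf s \<longleftrightarrow> children s = {#}"

definition internal_nodes :: "'a ltree \<Rightarrow> 'a ltree multiset" where
  "internal_nodes t = {#s \<in># nodes t. \<not> is_leaf s#}"

definition leaves :: "'a ltree \<Rightarrow> 'a ltree multiset" where
  "leaves t = {#s \<in># nodes t. is_leaf s#}"

definition adjacent_nodes :: "'a ltree \<Rightarrow> 'a ltree \<Rightarrow> 'a ltree \<Rightarrow> bool" where
  "adjacent_nodes t s s' \<longleftrightarrow>
     s \<in># nodes t \<and> s' \<in># nodes t \<and> (s' \<in># children s \<or> s \<in># children s')"

text \<open>
  The equation between multisets says that there are exactly \<open>card V\<close> leaves, one labeled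
  \<open>(v, 0)\<close> for each \<open>v \<in> V\<close>. The case \<open>card V = 1\<close> is the separate convention for the one-vertex
  graph.
\<close>

definition time_dependent_assembly_tree :: "'a pair_pre_digraph \<Rightarrow> 'a ltree \<Rightarrow> bool" where
  "time_dependent_assembly_tree G t \<longleftrightarrow>
     (let V = pverts G in
      if card V = 1 then t = Node V 0 {#}
      else
        (\<forall>s \<in># nodes t. vset s \<subseteq> V) \<and>
        image_mset (\<lambda>s. (vset s, time s)) (leaves t) = image_mset (\<lambda>v. ({v}, 0)) (mset_set V) \<and>
        (\<forall>s \<in># internal_nodes t. size (children s) \<ge> 2) \<and>
        vset t = V \<and> 1 \<le> time t \<and> time t \<le> card V - 1 \<and>
        (\<forall>s \<in># internal_nodes t. vset s = (\<Union>c \<in> set_mset (children s). vset c)) \<and>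
        (\<forall>s s'. adjacent_nodes t s s' \<and> vset s \<subseteq> vset s' \<longrightarrow> time s < time s') \<and>
        (\<forall>i \<le> time t. \<exists>s \<in># nodes t. time s = i))"

definition connected_gluing_rule :: "'a pair_pre_digraph \<Rightarrow> 'a ltree \<Rightarrow> bool" where
  "connected_gluing_rule G t \<longleftrightarrow>
     (\<forall>s \<in># internal_nodes t. connected (with_proj G \<restriction> vset s))"

text \<open>Only meant for connected finite simple graphs \<open>G\<close>.\<close>

definition num_assembly_trees :: "'a pair_pre_digraph \<Rightarrow> nat" ("a\<^sub>t\<^sup>C") where
  "a\<^sub>t\<^sup>C G = card {t. time_dependent_assembly_tree G t \<and> connected_gluing_rule G t}"

text \<open>
  The cyclic successor of \<open>u\<close> in \<open>1, \<dots>, n\<close> is \<open>u mod n + 1\<close>. The requirement \<open>u \<noteq> v\<close> removes the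
  loop for \<open>n = 1\<close>, and for \<open>n = 2\<close> the two directions give one edge, in accordance with the
  conventions for \<open>C\<^sub>1\<close> and \<open>C\<^sub>2\<close>.
\<close>

definition cycle_graph :: "nat \<Rightarrow> nat pair_pre_digraph" where
  "cycle_graph n = \<lparr> pverts = {1..n},
     parcs = {(u, v). u \<in> {1..n} \<and> v \<in> {1..n} \<and> u \<noteq> v \<and> (v = u mod n + 1 \<or> u = v mod n + 1)} \<rparr>"

lemma pair_graph_cycle_graph: "pair_graph (cycle_graph n)"
proof -
  have "finite (parcs (cycle_graph n))"
    by (rule finite_subset[of _ "{1..n} \<times> {1..n}"]) (auto simp: cycle_graph_def)
  then show ?thesis
    by unfold_locales (auto simp: cycle_graph_def symmetric_def intro: symI)
qed

lemma connected_cycle_graph: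
  assumes "n \<ge> 1"
  shows "connected (cycle_graph n)"
proof -
  interpret pair_graph "cycle_graph n" by (rule pair_graph_cycle_graph)
  have reach: "1 \<le> k \<Longrightarrow> k \<le> n \<Longrightarrow> 1 \<rightarrow>\<^sup>*\<^bsub>with_proj (cycle_graph n)\<^esub> k" for k
  proof (induction k rule: dec_induct)
    case base
    have "1 \<in> pverts (cycle_graph n)" using assms by (simp add: cycle_graph_def)
    then show ?case by simp
  next
    case (step k)
    then have "k \<rightarrow>\<^bsub>with_proj (cycle_graph n)\<^esub> Suc k"
      by (auto simp: cycle_graph_def)
    with step show ?case by (auto intro: reachable_adj_trans)
  qed
  have sym: "symmetric (cycle_graph n)" by (rule sym_arcs)
  have "strongly_connected (cycle_graph n)"
  proof (rule strongly_connectedI)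
    show "verts (cycle_graph n) \<noteq> {}" using assms by (auto simp: cycle_graph_def)
    fix u v assume "u \<in> verts (cycle_graph n)" "v \<in> verts (cycle_graph n)"
    then have "1 \<rightarrow>\<^sup>*\<^bsub>with_proj (cycle_graph n)\<^esub> u" "1 \<rightarrow>\<^sup>*\<^bsub>with_proj (cycle_graph n)\<^esub> v"
      using reach by (auto simp: cycle_graph_def)
    then show "u \<rightarrow>\<^sup>*\<^bsub>with_proj (cycle_graph n)\<^esub> v"
      using symmetric_reachable[OF sym] reachable_trans by blast
  qed
  then show ?thesis
    by (simp add: connected_def strongly_connected_def reachable_mk_symmetric_eq[OF sym])
qed

end

theory Submission
  imports Defs
begin

text \<open>
  A time-dependent assembly tree records a process: at time \<open>i\<close> the maximal nodes of time at most
  \<open>i\<close> partition the vertex set, and these partitions become strictly coarser with \<open>i\<close>, from the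
  singletons at time \<open>0\<close> to the single block \<open>V\<close> at the time of the root. Conversely, the tree is
  recovered from the partitions, because its nodes are the blocks that occur, each labeled by the
  first time at which it occurs. So \<open>bij_betw_chains_gluing_trees\<close> identifies the trees that obey
  the connected gluing rule with the strict chains, from the singletons to \<open>{V}\<close>, of partitions
  into connected blocks.

  For the cycle on \<open>n \<ge> 2\<close> vertices, a connected partition is given by the set of edges that run
  between different blocks. A set of edges arises in this way iff it does not consist of exactly one
  edge, since cutting a cycle at one edge leaves it connected; a finer partition has more cut edges
  (\<open>finer_iff_cut_edges\<close>). The singletons cut all \<open>n\<close> edges and \<open>{V}\<close> cuts none. Hence the trees
  are counted by the strictly decreasing chains of sets from an \<open>n\<close>-element set to \<open>{}\<close> that avoid
  sets of size \<open>1\<close>.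

  Let \<open>c n\<close> be the number of these chains. Splitting them by the second set of the chain, of size
  \<open>j < n\<close>, \<open>j \<noteq> 1\<close>, gives \<open>c 0 = 1\<close> and, for \<open>n \<ge> 2\<close>,
  \<open>c n = (\<Sum>j | j < n \<and> j \<noteq> 1. (n choose j) * c j)\<close>
  (\<open>card_set_chains\<close>). The term for \<open>j = 0\<close> is the \<open>1\<close> in the recurrence, and \<open>c j\<close> for \<open>j \<ge> 2\<close>
  is the number of trees of the cycle on \<open>j\<close> vertices.
\<close>

section \<open>Refinement of partitions\<close>

text \<open>
  Both partitions are taken of the same set; the relation is then a partial order
  (\<open>finer_antisym\<close>).
\<close>
definition finer :: "'a set set \<Rightarrow> 'a set set \<Rightarrow> bool" where
  "finer P Q \<longleftrightarrow> (\<forall>A \<in> P. \<exists>B \<in> Q. A \<subseteq> B)"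

definition strictly_finer :: "'a set set \<Rightarrow> 'a set set \<Rightarrow> bool" where
  "strictly_finer P Q \<longleftrightarrow> finer P Q \<and> P \<noteq> Q"

lemma finer_refl [simp]: "finer P P"
  by (auto simp: finer_def)

lemma block_eq: "partition_on V P \<Longrightarrow> A \<in> P \<Longrightarrow> B \<in> P \<Longrightarrow> x \<in> A \<Longrightarrow> x \<in> B \<Longrightarrow> A = B"
  by (auto simp: partition_on_def disjoint_def)

lemma block_obtain:
  assumes "partition_on V P" "x \<in> V" obtains A where "A \<in> P" "x \<in> A"
  using assms by (auto simp: partition_on_def)

lemma block_nonempty: "partition_on V P \<Longrightarrow> A \<in> P \<Longrightarrow> \<exists>x. x \<in> A \<and> x \<in> V"
  by (metis UnionI all_not_in_conv partition_on_def)

lemma finer_below: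
  assumes "partition_on V P" "partition_on V Q" "finer P Q" "B \<in> Q" "A \<in> P" "x \<in> A" "x \<in> B"
  shows "A \<subseteq> B"
proof -
  obtain B' where "B' \<in> Q" "A \<subseteq> B'" using assms by (auto simp: finer_def)
  then show ?thesis using block_eq[OF assms(2), of B B' x] assms by auto
qed

lemma finer_Union:
  assumes "partition_on V P" "partition_on V Q" "finer P Q" "B \<in> Q"
  shows "\<Union>{A \<in> P. A \<subseteq> B} = B"
proof (intro subset_antisym subsetI)
  fix x assume x: "x \<in> B"
  then have "x \<in> V" using assms(2,4) by (auto simp: partition_on_def)
  with assms(1) obtain A where A: "A \<in> P" "x \<in> A" by (rule block_obtain)
  then have "A \<subseteq> B" using finer_below[OF assms A x] by simp
  with A show "x \<in> \<Union>{A \<in> P. A \<subseteq> B}" by auto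
qed auto

text \<open>A partition cannot be a proper part of another one: the missing blocks would leave holes.\<close>
lemma partition_subset_eq:
  assumes "partition_on V P" "partition_on V Q" "P \<subseteq> Q"
  shows "P = Q"
proof (intro subset_antisym subsetI)
  fix B assume B: "B \<in> Q"
  then obtain x where x: "x \<in> B" "x \<in> V" using block_nonempty[OF assms(2)] by blast
  from assms(1) x(2) obtain A where "A \<in> P" "x \<in> A" by (rule block_obtain)
  then show "B \<in> P" using block_eq[OF assms(2) B, of A x] x assms(3) by auto
qed (use assms in auto)

lemma finer_antisym:
  assumes "partition_on V P" "partition_on V Q" "finer P Q" "finer Q P"
  shows "P = Q"
proof (rule partition_subset_eq[OF assms(1,2)], rule subsetI)
  fix A assume A: "A \<in> P"
  then obtain B where B: "B \<in> Q" "A \<subseteq> B" using assms(3) by (auto simp: finer_def)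
  obtain x where x: "x \<in> A" using block_nonempty[OF assms(1) A] by auto
  then have "B \<subseteq> A" using finer_below[OF assms(2,1,4) A B(1), of x] B by auto
  with A B show "A \<in> Q" by auto
qed

text \<open>
  Sending each block of \<open>P\<close> to the block of \<open>Q\<close> around it is onto \<open>Q\<close>. Were it injective, every
  block of \<open>Q\<close> would contain only one block of \<open>P\<close> and so be equal to it.
\<close>
lemma strictly_finer_card:
  assumes "finite V" "partition_on V P" "partition_on V Q" "strictly_finer P Q"
  shows "card Q < card P"
proof -
  have fin: "finite P" using assms(1,2) by (rule finite_elements)
  have fine: "finer P Q" "P \<noteq> Q" using assms(4) by (auto simp: strictly_finer_def)
  then obtain f where f: "\<And>A. A \<in> P \<Longrightarrow> f A \<in> Q \<and> A \<subseteq> f A" unfolding finer_def by metis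
  have onto: "\<exists>A \<in> P. x \<in> A \<and> f A = B" if "B \<in> Q" "x \<in> B" for B x
  proof -
    have "x \<in> V" using that assms(3) by (auto simp: partition_on_def)
    with assms(2) obtain A where A: "A \<in> P" "x \<in> A" by (rule block_obtain)
    then have "f A = B" using f[OF A(1)] block_eq[OF assms(3), of "f A" B x] that by auto
    with A show ?thesis by auto
  qed
  have "Q \<subseteq> f ` P"
  proof
    fix B assume B: "B \<in> Q"
    then obtain x where "x \<in> B" using block_nonempty[OF assms(3)] by blast
    with onto[OF B] show "B \<in> f ` P" by auto
  qed
  with f have im: "f ` P = Q" by auto
  then have "card Q \<le> card P" using card_image_le[OF fin, of f] by simp
  moreover have "card Q \<noteq> card P"
  proof
    assume "card Q = card P"
    with im fin have inj: "inj_on f P" by (intro eq_card_imp_inj_on) auto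
    have "f A = A" if A: "A \<in> P" for A
    proof -
      have "x \<in> A" if x: "x \<in> f A" for x
      proof -
        obtain A' where "A' \<in> P" "x \<in> A'" "f A' = f A" using onto[of "f A" x] f[OF A] x by auto
        with A inj show ?thesis by (metis inj_onD)
      qed
      with f[OF A] show ?thesis by auto
    qed
    with im fine(2) show False by auto
  qed
  ultimately show ?thesis by simp
qed

section \<open>Assembly trees by local conditions\<close>

lemma in_nodes_iff: "s \<in># nodes t \<longleftrightarrow> s = t \<or> (\<exists>c \<in># children t. s \<in># nodes c)"
  by (cases t) (auto simp: in_Union_mset_iff)

lemma self_in_nodes [simp]: "t \<in># nodes t"
  by (subst in_nodes_iff) simp

lemma nodes_trans: "s \<in># nodes t \<Longrightarrow> r \<in># nodes s \<Longrightarrow> r \<in># nodes t"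
proof (induction t)
  case (Node U i ts)
  then show ?case
    by (auto simp: in_nodes_iff[of s "Node U i ts"] in_nodes_iff[of r "Node U i ts"])
qed

lemma child_in_nodes: "s \<in># nodes t \<Longrightarrow> c \<in># children s \<Longrightarrow> c \<in># nodes t"
  using in_nodes_iff[of c s] self_in_nodes by (blast intro: nodes_trans)

lemma not_leaf_if_child: "c \<in># children t \<Longrightarrow> \<not> is_leaf t"
  by (auto simp: is_leaf_def)

lemma filter_mset_Union: "filter_mset P (\<Sum>\<^sub># M) = \<Sum>\<^sub># (image_mset (filter_mset P) M)"
  by (induction M) auto

lemma image_mset_Union: "image_mset f (\<Sum>\<^sub># M) = \<Sum>\<^sub># (image_mset (image_mset f) M)"
  by (induction M) auto

lemma leaves_leaf: "is_leaf t \<Longrightarrow> leaves t = {#t#}"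
  by (cases t) (auto simp: leaves_def is_leaf_def)

lemma leaves_internal: "\<not> is_leaf t \<Longrightarrow> leaves t = \<Sum>\<^sub># (image_mset leaves (children t))"
  by (cases t) (auto simp: leaves_def is_leaf_def filter_mset_Union image_mset.compositionality comp_def
      intro!: arg_cong[of _ _ sum_mset] image_mset_cong)

lemma leaves_child: "c \<in># children t \<Longrightarrow> leaves c \<subseteq># leaves t"
  by (subst leaves_internal[of t]) (auto simp: is_leaf_def dest!: multi_member_split)

lemma leaves_mono: "s \<in># nodes t \<Longrightarrow> leaves s \<subseteq># leaves t"
proof (induction t)
  case (Node U i ts)
  then show ?case
    using leaves_child[of _ "Node U i ts"] by (auto simp: in_nodes_iff[of s "Node U i ts"] intro: subset_mset.order_trans)
qed

text \<open>
  The conditions on a single node and its children to which the definition of an assembly tree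
  reduces. The last conjunct also forbids a child of multiplicity two, as no child has an empty
  vertex set.
\<close>
definition well_glued :: "'a ltree \<Rightarrow> bool" where
  "well_glued s \<longleftrightarrow>
     (if is_leaf s then time s = 0 \<and> is_singleton (vset s)
      else size (children s) \<ge> 2 \<and> vset s = (\<Union>c \<in> set_mset (children s). vset c) \<and>
        (\<forall>c \<in># children s. time c < time s) \<and>
        (\<forall>c d r. children s = add_mset c (add_mset d r) \<longrightarrow> vset c \<inter> vset d = {}))"

definition assembled :: "'a ltree \<Rightarrow> bool" where
  "assembled t \<longleftrightarrow> (\<forall>s \<in># nodes t. well_glued s)"

lemma assembled_node: "assembled t \<Longrightarrow> s \<in># nodes t \<Longrightarrow> assembled s"
  by (auto simp: assembled_def intro: nodes_trans)

lemma assembled_child: "assembled t \<Longrightarrow> c \<in># children t \<Longrightarrow> assembled c"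
  by (rule assembled_node) (auto intro: child_in_nodes[of t])

lemma assembled_iff: "assembled t \<longleftrightarrow> well_glued t \<and> (\<forall>c \<in># children t. assembled c)"
  unfolding assembled_def by (auto simp: in_nodes_iff[of _ t] intro: child_in_nodes)

lemma assembled_leafD: "assembled t \<Longrightarrow> is_leaf t \<Longrightarrow> time t = 0 \<and> is_singleton (vset t)"
  by (auto simp: assembled_def well_glued_def)

lemma assembled_internalD:
  assumes "assembled t" "\<not> is_leaf t"
  shows "size (children t) \<ge> 2" "vset t = (\<Union>c \<in> set_mset (children t). vset c)"
    "\<And>c. c \<in># children t \<Longrightarrow> time c < time t"
    "\<And>c d r. children t = add_mset c (add_mset d r) \<Longrightarrow> vset c \<inter> vset d = {}"
proof -
  have "well_glued t" using assms by (simp add: assembled_def)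
  with assms(2) show "size (children t) \<ge> 2" "vset t = (\<Union>c \<in> set_mset (children t). vset c)"
    "\<And>c. c \<in># children t \<Longrightarrow> time c < time t"
    "\<And>c d r. children t = add_mset c (add_mset d r) \<Longrightarrow> vset c \<inter> vset d = {}"
    unfolding well_glued_def by (simp_all split: if_splits)
qed

lemma assembled_vset_nonempty: "assembled t \<Longrightarrow> vset t \<noteq> {}"
proof (induction t)
  case (Node U i ts)
  show ?case
  proof (cases "ts = {#}")
    case True
    then show ?thesis using assembled_leafD[OF Node.prems]
      by (auto simp: is_leaf_def is_singleton_def)
  next
    case False
    then obtain c where c: "c \<in># ts" by auto
    then have "vset c \<noteq> {}" using Node assembled_child[OF Node.prems, of c] by simp
    moreover have "vset c \<subseteq> U"
      using c False assembled_internalD(2)[OF Node.prems] by (auto simp: is_leaf_def)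
    ultimately show ?thesis by auto
  qed
qed

lemma assembled_child_vset: "assembled t \<Longrightarrow> c \<in># children t \<Longrightarrow> vset c \<subseteq> vset t"
  using assembled_internalD(2)[OF _ not_leaf_if_child] by blast

lemma assembled_child_time: "assembled t \<Longrightarrow> c \<in># children t \<Longrightarrow> time c < time t"
  using assembled_internalD(3)[OF _ not_leaf_if_child] by blast

lemma assembled_node_vset: "assembled t \<Longrightarrow> s \<in># nodes t \<Longrightarrow> vset s \<subseteq> vset t"
proof (induction t)
  case (Node U i ts)
  then show ?case
    using assembled_child_vset[OF Node.prems(1)] assembled_child[OF Node.prems(1)]
    by (auto simp: in_nodes_iff[of s "Node U i ts"])
qed

lemma assembled_node_time: "assembled t \<Longrightarrow> s \<in># nodes t \<Longrightarrow> s = t \<or> time s < time t"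
proof (induction t)
  case (Node U i ts)
  then show ?case
    using assembled_child_time[OF Node.prems(1)] assembled_child[OF Node.prems(1)]
    by (fastforce simp: in_nodes_iff[of s "Node U i ts"])
qed

lemma assembled_children_disjoint:
  assumes "assembled t" "c \<in># children t" "d \<in># children t" "c \<noteq> d"
  shows "vset c \<inter> vset d = {}"
proof -
  obtain r where r: "children t = add_mset c r" using assms by (meson multi_member_split)
  with assms obtain r' where "r = add_mset d r'" by (metis insert_noteq_member multi_member_split)
  with r assembled_internalD(4)[of t c d r'] assms show ?thesis by (auto simp: is_leaf_def)
qed

lemma assembled_children_mset_set:
  assumes "assembled t"
  shows "children t = mset_set (set_mset (children t))"
proof -
  have le: "count (children t) c \<le> 1" for c
  proof (rule ccontr)
    assume "\<not> count (children t) c \<le> 1"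
    then have "replicate_mset 2 c \<subseteq># children t" by (intro count_le_replicate_mset_subset_eq[THEN iffD1]) simp
    then obtain r where r: "children t = add_mset c (add_mset c r)"
      by (auto simp: subset_mset.le_iff_add numeral_2_eq_2)
    then have "vset c \<inter> vset c = {}"
      using assembled_internalD(4)[OF assms, of c c r] by (auto simp: is_leaf_def)
    moreover have "vset c \<noteq> {}"
      using r by (intro assembled_vset_nonempty assembled_child[OF assms]) simp
    ultimately show False by simp
  qed
  have "count (children t) c = count (mset_set (set_mset (children t))) c" for c
  proof (cases "c \<in># children t")
    case True
    with le[of c] have "count (children t) c = 1"
      using count_greater_zero_iff[of "children t" c] by linarith
    with True show ?thesis by simp
  qed (simp add: not_in_iff)
  then show ?thesis by (rule multiset_eqI)
qed

lemma assembled_child_psubset: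
  assumes "assembled t" "c \<in># children t"
  shows "vset c \<subset> vset t"
proof -
  obtain r where r: "children t = add_mset c r" using assms by (meson multi_member_split)
  have "\<not> is_leaf t" using assms by (auto simp: is_leaf_def)
  with assms r have "size r \<ge> 1" using assembled_internalD(1)[of t] by auto
  then obtain d r' where "r = add_mset d r'" by (cases r) auto
  then have "vset c \<inter> vset d = {}" "d \<in># children t"
    using assembled_internalD(4)[OF assms(1) \<open>\<not> is_leaf t\<close>] r by auto
  then show ?thesis
    using assembled_child_vset[OF assms(1)] assms(2) assembled_vset_nonempty[OF assembled_child[OF assms(1)], of d]
    by blast
qed

text \<open>Disjointness makes the leaf labels of the children add up without repetition.\<close>
lemma mset_set_UN_disjoint:
  assumes "finite D" "\<And>c. c \<in> D \<Longrightarrow> finite (f c)" "disjoint_family_on f D"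
  shows "mset_set (\<Union>c\<in>D. f c) = (\<Sum>c\<in>D. mset_set (f c))"
  using assms
proof (induction D rule: finite_induct)
  case (insert x F)
  then have "f x \<inter> \<Union> (f ` F) = {}" by (fastforce simp: disjoint_family_on_def)
  with insert show ?case by (simp add: mset_set_Union disjoint_family_on_insert)
qed simp

lemma assembled_leaf_labels:
  assumes "assembled t" "finite (vset t)"
  shows "image_mset (\<lambda>s. (vset s, time s)) (leaves t)
    = image_mset (\<lambda>v. ({v}, 0)) (mset_set (vset t))"
  using assms
proof (induction t)
  case (Node U i ts)
  let ?t = "Node U i ts"
  show ?case
  proof (cases "is_leaf ?t")
    case True
    then show ?thesis using assembled_leafD[OF Node.prems(1)]
      by (auto simp: leaves_leaf is_singleton_def)
  next
    case False
    let ?D = "set_mset ts"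
    have ts: "ts = mset_set ?D" using assembled_children_mset_set[OF Node.prems(1)] by simp
    have U: "U = (\<Union>c\<in>?D. vset c)" using assembled_internalD(2)[OF Node.prems(1) False] by simp
    have fin: "finite (vset c)" if "c \<in> ?D" for c
      using U Node.prems that by (auto intro: finite_subset)
    have disj: "disjoint_family_on vset ?D"
      using assembled_children_disjoint[OF Node.prems(1)] by (auto simp: disjoint_family_on_def)
    have "image_mset (\<lambda>s. (vset s, time s)) (leaves ?t)
        = \<Sum>\<^sub># (image_mset (\<lambda>c. image_mset (\<lambda>s. (vset s, time s)) (leaves c)) ts)"
      by (simp add: leaves_internal[OF False] image_mset_Union image_mset.compositionality comp_def)
    also have "\<dots> = \<Sum>\<^sub># (image_mset (\<lambda>c. image_mset (\<lambda>v. ({v}, 0)) (mset_set (vset c))) ts)"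
      using Node.IH fin assembled_child[OF Node.prems(1)]
      by (intro arg_cong[of _ _ sum_mset] image_mset_cong) auto
    also have "\<dots> = image_mset (\<lambda>v. ({v}, 0)) (\<Sum>\<^sub># (image_mset (\<lambda>c. mset_set (vset c)) ts))"
      by (simp add: image_mset_Union image_mset.compositionality comp_def)
    also have "\<Sum>\<^sub># (image_mset (\<lambda>c. mset_set (vset c)) ts) = (\<Sum>c\<in>?D. mset_set (vset c))"
      by (subst ts) (rule sum_unfold_sum_mset[symmetric])
    also have "\<dots> = mset_set U"
      using fin disj U by (simp add: mset_set_UN_disjoint)
    finally show ?thesis by simp
  qed
qed

text \<open>
  Used before disjointness of siblings is known: a vertex shared by two siblings sits in a leaf below
  each of them.
\<close>
lemma vset_leaves:
  assumes "\<And>s. s \<in># nodes t \<Longrightarrow> \<not> is_leaf s \<Longrightarrow> vset s = (\<Union>c \<in> set_mset (children s). vset c)"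
  shows "vset t = (\<Union>l \<in> set_mset (leaves t). vset l)"
  using assms
proof (induction t)
  case (Node U i ts)
  show ?case
  proof (cases "is_leaf (Node U i ts)")
    case False
    have "vset c = (\<Union>l \<in> set_mset (leaves c). vset l)" if "c \<in># ts" for c
      using that child_in_nodes[of _ "Node U i ts"]
      by (intro Node.IH Node.prems) (auto simp: in_nodes_iff[of _ "Node U i ts"])
    then show ?thesis
      using Node.prems[of "Node U i ts"] False by (auto simp: leaves_internal)
  qed (simp add: leaves_leaf)
qed

text \<open>
  The one condition that is not local to begin with is disjointness of siblings. If two siblings had
  a common vertex \<open>x\<close>, each would have a leaf labeled \<open>({x}, 0)\<close> below it, whereas the multiset
  of leaf labels contains every label at most once.
\<close>
lemma time_dependent_assembly_tree_imp_assembled: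
  fixes G :: "'a pair_pre_digraph"
  assumes tree: "time_dependent_assembly_tree G t" and card: "card (pverts G) \<ge> 2"
  shows "assembled t"
  unfolding assembled_def
proof
  define V where "V = pverts G"
  have fin: "finite V" using card unfolding V_def by (metis card.infinite not_numeral_le_zero)
  have labels: "image_mset (\<lambda>s. (vset s, time s)) (leaves t) = image_mset (\<lambda>v. ({v}, 0)) (mset_set V)"
    and size: "\<And>s. s \<in># nodes t \<Longrightarrow> \<not> is_leaf s \<Longrightarrow> size (children s) \<ge> 2"
    and un: "\<And>s. s \<in># nodes t \<Longrightarrow> \<not> is_leaf s \<Longrightarrow> vset s = (\<Union>c \<in> set_mset (children s). vset c)"
    and adj: "\<And>s s'. adjacent_nodes t s s' \<Longrightarrow> vset s \<subseteq> vset s' \<Longrightarrow> time s < time s'"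
    using tree card unfolding time_dependent_assembly_tree_def Let_def V_def internal_nodes_def
    by auto
  fix s assume s: "s \<in># nodes t"
  have leafD: "\<exists>v. vset l = {v} \<and> time l = 0" if "l \<in># leaves t" for l
  proof -
    have "(vset l, time l) \<in># image_mset (\<lambda>v. ({v}, 0)) (mset_set V)"
      using that unfolding labels[symmetric] by auto
    then show ?thesis by auto
  qed
  show "well_glued s"
  proof (cases "is_leaf s")
    case True
    with s leafD[of s] show ?thesis by (auto simp: well_glued_def leaves_def)
  next
    case False
    have "vset c \<inter> vset d = {}" if cd: "children s = add_mset c (add_mset d r)" for c d r
    proof (rule ccontr)
      assume "vset c \<inter> vset d \<noteq> {}"
      then obtain x where x: "x \<in> vset c" "x \<in> vset d" by auto
      have c: "c \<in># nodes t" "d \<in># nodes t" using s cd by (auto intro: child_in_nodes)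
      have "vset c = (\<Union>l \<in> set_mset (leaves c). vset l)" "vset d = (\<Union>l \<in> set_mset (leaves d). vset l)"
        using un c by (auto intro!: vset_leaves intro: nodes_trans)
      with x obtain l l' where l: "l \<in># leaves c" "x \<in> vset l" "l' \<in># leaves d" "x \<in> vset l'"
        by auto
      have "leaves c + leaves d \<subseteq># leaves s"
        using cd False by (simp add: leaves_internal)
      with leaves_mono[OF s] have sub: "leaves c + leaves d \<subseteq># leaves t" by (rule subset_mset.order_trans[rotated])
      then have "l \<in># leaves t" "l' \<in># leaves t" using l mset_subset_eqD by fastforce+
      with l leafD have lab: "vset l = {x}" "time l = 0" "vset l' = {x}" "time l' = 0" by fastforce+
      \<comment> \<open>Here \<open>l\<close> and \<open>l'\<close> may be equal as trees, so both copies have to be kept in a multiset.\<close>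
      have "{#({x}, 0), ({x}, 0)#} = image_mset (\<lambda>s. (vset s, time s)) {#l, l'#}" using lab by simp
      also have "\<dots> \<subseteq># image_mset (\<lambda>s. (vset s, time s)) (leaves t)"
        using l by (intro image_mset_subseteq_mono subset_mset.order_trans[OF _ sub])
          (metis add_mset_add_single mset_subset_eq_single subset_mset.add_mono union_mset_add_mset_left add_mset_commute)
      also have "\<dots> = mset_set ((\<lambda>v. ({v}, 0)) ` V)"
        unfolding labels by (rule image_mset_mset_set) (auto simp: inj_on_def)
      finally have "count (mset_set ((\<lambda>v. ({v}, 0::nat)) ` V)) ({x}, 0) \<ge> 2"
        by (metis count_add_mset count_empty mset_subset_eq_count numeral_2_eq_2)
      then show False by (simp add: count_mset_set' split: if_splits)
    qed
    moreover have "time c < time s" if "c \<in># children s" for c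
      using that un[OF s False] s child_in_nodes[OF s that]
      by (intro adj) (auto simp: adjacent_nodes_def)
    ultimately show ?thesis using False size[OF s] un[OF s] by (simp add: well_glued_def)
  qed
qed

text \<open>
  For the converse, siblings are disjoint and nonempty and each internal node has at least two
  children, so a child is a proper subset of its parent. Hence \<open>vset s \<subseteq> vset s'\<close> for adjacent
  nodes means that \<open>s\<close> is the child, and the condition on times is the one in \<open>well_glued\<close>.
\<close>
lemma time_dependent_assembly_tree_iff:
  fixes G :: "'a pair_pre_digraph"
  assumes card: "card (pverts G) \<ge> 2"
  shows "time_dependent_assembly_tree G t \<longleftrightarrow>
    assembled t \<and> vset t = pverts G \<and> time t \<le> card (pverts G) - 1 \<and>
    (\<forall>i \<le> time t. \<exists>s \<in># nodes t. time s = i)" (is "?L \<longleftrightarrow> ?R")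
proof
  assume ?L
  with time_dependent_assembly_tree_imp_assembled[OF this card] card show ?R
    by (auto simp: time_dependent_assembly_tree_def Let_def)
next
  assume R: ?R
  then have t: "assembled t" and V: "vset t = pverts G" by auto
  have fin: "finite (pverts G)" using card by (metis card.infinite not_numeral_le_zero)
  have "\<not> is_leaf t"
    using assembled_leafD[OF t] card V by (auto simp: is_singleton_altdef)
  then obtain c where "c \<in># children t" by (auto simp: is_leaf_def)
  then have "1 \<le> time t" using assembled_child_time[OF t] by fastforce
  moreover have "time s < time s'" if "adjacent_nodes t s s'" "vset s \<subseteq> vset s'" for s s'
    using that t assembled_child_psubset[of s s'] assembled_child_time[of s' s] assembled_node
    unfolding adjacent_nodes_def by blast
  moreover have "size (children s) \<ge> 2" "vset s = (\<Union>c \<in> set_mset (children s). vset c)"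
    if "s \<in># internal_nodes t" for s
    using that assembled_internalD(1,2)[of s] assembled_node[OF t] by (auto simp: internal_nodes_def)
  ultimately show ?L
    using R fin assembled_leaf_labels[OF t] assembled_node_vset[OF t] card
    unfolding time_dependent_assembly_tree_def Let_def by auto
qed

section \<open>The partitions read off a tree\<close>

text \<open>
  The components that are present at time \<open>i\<close>. When times decrease from parent to child, these are
  the maximal subtrees whose root has time at most \<open>i\<close>.
\<close>
primrec live :: "'a ltree \<Rightarrow> nat \<Rightarrow> 'a ltree set" where
  "live (Node U j ts) =
     (\<lambda>i. if j \<le> i then {Node U j ts} else \<Union>f \<in> set_mset (image_mset live ts). f i)"

definition blocks_at :: "'a ltree \<Rightarrow> nat \<Rightarrow> 'a set set" where
  "blocks_at t i = vset ` live t i"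

lemma live_eq: "live t i = (if time t \<le> i then {t} else \<Union>c \<in> set_mset (children t). live c i)"
  by (cases t) auto

text \<open>Descent from the root along the path to a component that is present at time \<open>i\<close>.\<close>
lemma live_induct [consumes 1, case_names present child]:
  assumes "s \<in> live t i"
    and "\<And>t. time t \<le> i \<Longrightarrow> s = t \<Longrightarrow> Q t"
    and "\<And>t c. i < time t \<Longrightarrow> c \<in># children t \<Longrightarrow> s \<in> live c i \<Longrightarrow> Q c \<Longrightarrow> Q t"
  shows "Q t"
  using assms(1)
proof (induction t)
  case (Node U j ts)
  then show ?case using assms(2)[of "Node U j ts"] assms(3)[of "Node U j ts"]
    by (auto split: if_splits simp: not_le)
qed

lemma live_node: "s \<in> live t i \<Longrightarrow> s \<in># nodes t"
proof (induction rule: live_induct)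
  case (child t c)
  then show ?case by (auto simp: in_nodes_iff[of s t])
qed simp

lemma live_time: "s \<in> live t i \<Longrightarrow> time s \<le> i"
  by (induction rule: live_induct) auto

text \<open>
  Going back in time splits each component \<open>s\<close> on its own, without regard to the tree around it.
\<close>
lemma live_mono: "s \<in> live t k \<Longrightarrow> i \<le> k \<Longrightarrow> live s i \<subseteq> live t i"
proof (induction rule: live_induct)
  case (child t c)
  then show ?case by (auto simp: live_eq[of t i])
qed simp

lemma live_covers: "assembled t \<Longrightarrow> (\<Union>s \<in> live t i. vset s) = vset t"
proof (induction t)
  case (Node U j ts)
  show ?case
  proof (cases "j \<le> i")
    case False
    then have nl: "\<not> is_leaf (Node U j ts)" using assembled_leafD[OF Node.prems] by auto
    have "(\<Union>s \<in> live (Node U j ts) i. vset s) = (\<Union>c \<in> set_mset ts. \<Union>s \<in> live c i. vset s)"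
      using False by auto
    also have "\<dots> = (\<Union>c \<in> set_mset ts. vset c)"
      using Node.IH assembled_child[OF Node.prems] by simp
    also have "\<dots> = U" using assembled_internalD(2)[OF Node.prems nl] by simp
    finally show ?thesis by (simp only: ltree.sel)
  qed auto
qed

lemma live_disjoint:
  assumes "assembled t" "s \<in> live t i" "r \<in> live t i" "x \<in> vset s" "x \<in> vset r"
  shows "s = r"
  using assms
proof (induction t)
  case (Node U j ts)
  show ?case
  proof (cases "j \<le> i")
    case True
    with Node.prems show ?thesis by simp
  next
    case False
    with Node.prems obtain c d where cd: "c \<in># ts" "s \<in> live c i" "d \<in># ts" "r \<in> live d i" by auto
    then have as: "assembled c" "assembled d" using assembled_child[OF Node.prems(1)] by auto
    then have "x \<in> vset c" "x \<in> vset d"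
      using assembled_node_vset live_node cd Node.prems(4,5) by blast+
    then have "c = d" using assembled_children_disjoint[OF Node.prems(1), of c d] cd by auto
    with Node.IH[OF cd(1) as(1)] cd Node.prems show ?thesis by simp
  qed
qed

lemma node_live: "assembled t \<Longrightarrow> s \<in># nodes t \<Longrightarrow> s \<in> live t (time s)"
proof (induction t)
  case (Node U j ts)
  from assembled_node_time[OF Node.prems] show ?case
  proof
    assume "time s < time (Node U j ts)"
    moreover from this obtain c where "c \<in># ts" "s \<in># nodes c"
      using Node.prems(2) by (auto simp: in_nodes_iff[of s "Node U j ts"])
    ultimately show ?thesis using Node.IH[of c] assembled_child[OF Node.prems(1)] by auto
  qed simp
qed

lemma live_child:
  assumes "assembled t" "s \<in> live t (Suc i)" "time s = Suc i" "c \<in># children s"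
  shows "c \<in> live t i"
proof -
  have "assembled s" using assms live_node assembled_node by blast
  then have "time c \<le> i" using assembled_child_time assms by fastforce
  then have "c \<in> live c i" by (simp add: live_eq[of c])
  then have "c \<in> live s i" using assms by (auto simp: live_eq[of s])
  then show ?thesis using live_mono[OF assms(2), of i] by auto
qed

lemma inj_on_vset_live: "assembled t \<Longrightarrow> inj_on vset (live t i)"
  using live_disjoint[of t _ i] assembled_vset_nonempty assembled_node live_node
  by (metis all_not_in_conv inj_onI)

text \<open>
  A node formed at time \<open>i + 1\<close> glues exactly the components present at time \<open>i\<close> that lie inside
  it. This is why the children of a node can be recovered from the partition one step earlier.
\<close>
lemma live_below:
  assumes "assembled t" "s \<in> live t (Suc i)" "time s = Suc i"
  shows "{w \<in> live t i. vset w \<subseteq> vset s} = set_mset (children s)"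
proof (intro subset_antisym subsetI)
  have s: "assembled s" using assms live_node assembled_node by blast
  then have nl: "\<not> is_leaf s" using assms assembled_leafD by fastforce
  {
    fix w assume w: "w \<in> {w \<in> live t i. vset w \<subseteq> vset s}"
    then have "vset w \<noteq> {}" using assms(1) assembled_vset_nonempty assembled_node live_node by blast
    then obtain x where x: "x \<in> vset w" by auto
    then obtain c where c: "c \<in># children s" "x \<in> vset c"
      using w assembled_internalD(2)[OF s nl] by auto
    then have "w = c" using live_child[OF assms c(1)] w x live_disjoint[OF assms(1)] by blast
    with c show "w \<in># children s" by simp
  next
    fix c assume "c \<in># children s"
    then show "c \<in> {w \<in> live t i. vset w \<subseteq> vset s}"
      using live_child[OF assms] assembled_child_vset[OF s] by auto
  }
qed

lemma blocks_at_partition: "assembled t \<Longrightarrow> partition_on (vset t) (blocks_at t i)"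
proof (rule partition_onI)
  assume t: "assembled t"
  show "\<Union> (blocks_at t i) = vset t" using live_covers[OF t] by (simp add: blocks_at_def)
  show "disjnt p q" if "p \<in> blocks_at t i" "q \<in> blocks_at t i" "p \<noteq> q" for p q
    using that live_disjoint[OF t, of _ i] by (fastforce simp: blocks_at_def disjnt_iff)
  show "{} \<notin> blocks_at t i"
    using assembled_vset_nonempty assembled_node[OF t] live_node by (fastforce simp: blocks_at_def)
qed

lemma blocks_at_finer:
  assumes t: "assembled t" and "i \<le> k"
  shows "finer (blocks_at t i) (blocks_at t k)"
  unfolding finer_def
proof
  fix A assume "A \<in> blocks_at t i"
  then obtain s where s: "s \<in> live t i" "A = vset s" by (auto simp: blocks_at_def)
  then have "assembled s" using t live_node assembled_node by blast
  then obtain x where x: "x \<in> vset s" using assembled_vset_nonempty by blast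
  have "vset s \<subseteq> vset t" using s live_node assembled_node_vset[OF t] by blast
  with x have "x \<in> vset t" by auto
  then obtain r where r: "r \<in> live t k" "x \<in> vset r" using live_covers[OF t, of k] by auto
  then have "assembled r" using t live_node assembled_node by blast
  with r obtain w where w: "w \<in> live r i" "x \<in> vset w" using live_covers[of r i] by auto
  then have "w = s" using live_mono[OF r(1) assms(2)] live_disjoint[OF t _ s(1)] x by blast
  then have "vset s \<subseteq> vset r" using w live_node assembled_node_vset[OF \<open>assembled r\<close>] by blast
  with r s show "\<exists>B\<in>blocks_at t k. A \<subseteq> B" by (auto simp: blocks_at_def)
qed

lemma blocks_at_0: assumes t: "assembled t" shows "blocks_at t 0 = (\<lambda>v. {v}) ` vset t"
proof -
  have "is_singleton A" if A: "A \<in> blocks_at t 0" for A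
  proof -
    from A obtain s where s: "s \<in> live t 0" "A = vset s" by (auto simp: blocks_at_def)
    then have "assembled s" using t live_node assembled_node by blast
    moreover have "is_leaf s"
      using live_time[OF s(1)] assembled_child_time[OF \<open>assembled s\<close>] by (fastforce simp: is_leaf_def)
    ultimately show ?thesis using assembled_leafD s by blast
  qed
  then have "blocks_at t 0 \<subseteq> (\<lambda>v. {v}) ` vset t"
    using partition_onD1[OF blocks_at_partition[OF t, of 0]] by (fastforce simp: is_singleton_def)
  then show ?thesis
    using blocks_at_partition[OF t] partition_on_singletons by (rule_tac partition_subset_eq) auto
qed

lemma blocks_at_time: "blocks_at t (time t) = {vset t}"
  by (simp add: blocks_at_def live_eq[of t])

text \<open>
  A block keeps its label once it has been formed: the block of a node of time \<open>i + 1\<close> is not yet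
  present at time \<open>i\<close>, where only the proper parts of it exist.
\<close>
lemma new_node_not_in_blocks_at:
  assumes t: "assembled t" and s: "s \<in># nodes t" "time s = Suc i"
  shows "vset s \<in> blocks_at t (Suc i)" "vset s \<notin> blocks_at t i"
proof -
  have live: "s \<in> live t (Suc i)" using node_live[OF t s(1)] s(2) by simp
  then show "vset s \<in> blocks_at t (Suc i)" by (simp add: blocks_at_def)
  have as: "assembled s" using t s assembled_node by blast
  show "vset s \<notin> blocks_at t i"
  proof
    assume "vset s \<in> blocks_at t i"
    then obtain w where w: "w \<in> live t i" "vset w = vset s" by (auto simp: blocks_at_def)
    then have "w \<in># children s" using live_below[OF t live s(2)] by auto
    with assembled_child_psubset[OF as] w show False by auto
  qed
qed

text \<open>Strictness comes from the condition that every time up to that of the root is used.\<close>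
lemma blocks_at_strictly_finer:
  assumes t: "assembled t" and times: "\<And>i. i \<le> time t \<Longrightarrow> \<exists>s \<in># nodes t. time s = i"
    and "i < k" "k \<le> time t"
  shows "strictly_finer (blocks_at t i) (blocks_at t k)"
  unfolding strictly_finer_def
proof
  show "finer (blocks_at t i) (blocks_at t k)" using assms by (intro blocks_at_finer) auto
  from assms(3,4) have "Suc i \<le> time t" by simp
  from times[OF this] obtain s where s: "s \<in># nodes t" "time s = Suc i" by blast
  show "blocks_at t i \<noteq> blocks_at t k"
  proof
    assume "blocks_at t i = blocks_at t k"
    then have "finer (blocks_at t (Suc i)) (blocks_at t i)" using blocks_at_finer[OF t, of "Suc i" k] assms by simp
    then have "blocks_at t i = blocks_at t (Suc i)"
      using blocks_at_finer[OF t, of i "Suc i"] by (intro finer_antisym[OF blocks_at_partition[OF t] blocks_at_partition[OF t]]) auto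
    with new_node_not_in_blocks_at[OF t s] show False by simp
  qed
qed

section \<open>The tree grown from a chain of partitions\<close>

text \<open>
  The subtree for the block \<open>U\<close> of the partition \<open>P i\<close>. If \<open>U\<close> is already a block of the previous
  partition, it keeps its subtree, and with it its earlier time; otherwise a new node collects the
  blocks that \<open>U\<close> is made of.
\<close>
primrec grow :: "(nat \<Rightarrow> 'a set set) \<Rightarrow> nat \<Rightarrow> 'a set \<Rightarrow> 'a ltree" where
  "grow P 0 U = Node U 0 {#}"
| "grow P (Suc i) U =
     (if U \<in> P i then grow P i U
      else Node U (Suc i) (image_mset (grow P i) (mset_set {B \<in> P i. B \<subseteq> U})))"

lemma grow_cong: "(\<And>k. k < i \<Longrightarrow> P k = Q k) \<Longrightarrow> grow P i U = grow Q i U"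
  by (induction i arbitrary: U) (auto intro!: image_mset_cong)

lemma vset_grow [simp]: "vset (grow P i U) = U"
  by (induction i) auto

lemma time_grow_le: "time (grow P i U) \<le> i"
  by (induction i) auto

text \<open>Growing from the partitions of a tree gives back the tree.\<close>
lemma grow_blocks_at:
  assumes t: "assembled t"
  shows "s \<in> live t i \<Longrightarrow> grow (blocks_at t) i (vset s) = s"
proof (induction i arbitrary: s)
  case 0
  then have s: "assembled s" using t live_node assembled_node by blast
  have "time s = 0" using live_time[OF 0] by simp
  then have "is_leaf s" using assembled_child_time[OF s] by (fastforce simp: is_leaf_def)
  with \<open>time s = 0\<close> show ?case by (cases s) (auto simp: is_leaf_def)
next
  case (Suc i)
  then have s: "assembled s" using t live_node assembled_node by blast
  show ?case
  proof (cases "time s \<le> i")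
    case True
    then have "s \<in> live s i" by (simp add: live_eq[of s])
    then have "s \<in> live t i" using live_mono[OF Suc.prems, of i] by auto
    then show ?thesis using Suc.IH[of s] by (simp add: blocks_at_def)
  next
    case False
    then have time: "time s = Suc i" using live_time[OF Suc.prems] by simp
    let ?D = "set_mset (children s)"
    have below: "{w \<in> live t i. vset w \<subseteq> vset s} = ?D" by (rule live_below[OF t Suc.prems time])
    have "{B \<in> blocks_at t i. B \<subseteq> vset s} = vset ` {w \<in> live t i. vset w \<subseteq> vset s}" by (auto simp: blocks_at_def)
    also have "\<dots> = vset ` ?D" by (simp only: below)
    finally have "mset_set {B \<in> blocks_at t i. B \<subseteq> vset s} = mset_set (vset ` ?D)" by simp
    also have "\<dots> = image_mset vset (mset_set ?D)"
      using inj_on_vset_live[OF t, of i] below by (intro image_mset_mset_set[symmetric]) (auto simp: inj_on_def)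
    also have "mset_set ?D = children s" using assembled_children_mset_set[OF s] by simp
    finally have "image_mset (grow (blocks_at t) i) (mset_set {B \<in> blocks_at t i. B \<subseteq> vset s})
        = image_mset (\<lambda>w. grow (blocks_at t) i (vset w)) (children s)"
      by (simp add: image_mset.compositionality comp_def)
    also have "\<dots> = image_mset (\<lambda>w. w) (children s)"
      using Suc.IH below by (intro image_mset_cong) auto
    finally have "image_mset (grow (blocks_at t) i) (mset_set {B \<in> blocks_at t i. B \<subseteq> vset s}) = children s" by simp
    moreover have "vset s \<notin> blocks_at t i" using new_node_not_in_blocks_at[OF t live_node[OF Suc.prems] time] by simp
    ultimately show ?thesis using time by (cases s) simp
  qed
qed

locale partition_chain =
  fixes V :: "'a set" and P :: "nat \<Rightarrow> 'a set set" and m :: nat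
  assumes finite_V: "finite V"
    and partition: "i \<le> m \<Longrightarrow> partition_on V (P i)"
    and singletons: "P 0 = (\<lambda>v. {v}) ` V"
    and strict: "i < k \<Longrightarrow> k \<le> m \<Longrightarrow> strictly_finer (P i) (P k)"
begin

lemma chain_finer: "i \<le> k \<Longrightarrow> k \<le> m \<Longrightarrow> finer (P i) (P k)"
  using strict[of i k] by (cases "i = k") (auto simp: strictly_finer_def)

lemma finite_below: "i \<le> m \<Longrightarrow> finite {B \<in> P i. B \<subseteq> U}"
  using finite_elements[OF finite_V partition] by simp

text \<open>
  A new node has at least two children: \<open>U\<close> is the union of the blocks of \<open>P j\<close> inside it, and if
  there were only one, it would be \<open>U\<close> itself, against \<open>U \<notin> P j\<close>.
\<close>
lemma assembled_grow: "j \<le> m \<Longrightarrow> U \<in> P j \<Longrightarrow> assembled (grow P j U)"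
proof (induction j arbitrary: U)
  case 0
  then show ?case by (subst assembled_iff) (auto simp: well_glued_def is_leaf_def singletons)
next
  case (Suc j)
  then have j: "j \<le> m" by simp
  show ?case
  proof (cases "U \<in> P j")
    case True
    with Suc j show ?thesis by simp
  next
    case False
    let ?D = "{B \<in> P j. B \<subseteq> U}"
    have fin: "finite ?D" using finite_below[OF j] .
    have U: "\<Union>?D = U"
      using partition[OF j] partition[OF Suc.prems(1)] chain_finer[of j "Suc j"] Suc.prems
      by (intro finer_Union) auto
    have "U \<noteq> {}" using block_nonempty[OF partition[OF Suc.prems(1)] Suc.prems(2)] by auto
    then have "?D \<noteq> {}" using U by auto
    moreover have "?D \<noteq> {B}" for B using U False by auto
    ultimately have "card ?D \<noteq> 0" "card ?D \<noteq> 1"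
      using fin by (simp, metis card_1_singletonE)
    then have "card ?D \<ge> 2" by linarith
    moreover have "vset c \<inter> vset d = {}"
      if *: "image_mset (grow P j) (mset_set ?D) = add_mset c (add_mset d r)" for c d r
    proof -
      have "image_mset vset (image_mset (grow P j) (mset_set ?D)) = mset_set ?D"
        by (simp add: image_mset.compositionality comp_def)
      with * have **: "mset_set ?D = add_mset (vset c) (add_mset (vset d) (image_mset vset r))" by simp
      have "count (mset_set ?D) (vset c) \<le> 1" by (simp add: count_mset_set')
      with ** have "vset c \<noteq> vset d" by auto
      moreover have "vset c \<in># mset_set ?D" "vset d \<in># mset_set ?D" unfolding ** by auto
      ultimately show ?thesis using fin block_eq[OF partition[OF j]] by auto
    qed
    moreover have "time (grow P j B) < Suc j" for B using time_grow_le[of P j B] by simp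
    ultimately have "well_glued (grow P (Suc j) U)"
      using False fin U \<open>?D \<noteq> {}\<close> by (simp add: well_glued_def is_leaf_def mset_set_empty_iff)
    with Suc.IH j fin False show ?thesis by (subst assembled_iff) auto
  qed
qed

text \<open>
  Hence the chain can be read off the grown tree. In the step for a new node of time \<open>j + 1 > i\<close>,
  what is present at time \<open>i\<close> is present in one of its children, and every block of \<open>P i\<close> inside
  \<open>U\<close> lies inside exactly one of these.
\<close>
lemma live_grow:
  "i \<le> j \<Longrightarrow> j \<le> m \<Longrightarrow> U \<in> P j \<Longrightarrow> live (grow P j U) i = grow P i ` {B \<in> P i. B \<subseteq> U}"
proof (induction j arbitrary: U rule: dec_induct)
  case base
  have "{B \<in> P i. B \<subseteq> U} = {U}"
  proof -
    have "B = U" if "B \<in> P i" "B \<subseteq> U" for B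
      using block_nonempty[OF partition[OF base(1)] that(1)] block_eq[OF partition[OF base(1)] that(1) base(2)] that
      by auto
    with base show ?thesis by auto
  qed
  then show ?case by (simp add: live_eq[of "grow P i U"] time_grow_le)
next
  case (step j)
  then have j: "j \<le> m" by simp
  show ?case
  proof (cases "U \<in> P j")
    case True
    with step j show ?thesis by simp
  next
    case False
    let ?D = "{B \<in> P j. B \<subseteq> U}"
    have "live (grow P (Suc j) U) i = (\<Union>B\<in>?D. live (grow P j B) i)"
      using False step.hyps finite_below[OF j] by (simp add: live_eq[of "Node _ _ _"])
    also have "\<dots> = (\<Union>B\<in>?D. grow P i ` {A \<in> P i. A \<subseteq> B})"
      using step.IH j by simp
    also have "\<dots> = grow P i ` {A \<in> P i. A \<subseteq> U}"
    proof -
      have "\<exists>B\<in>?D. A \<subseteq> B" if A: "A \<in> P i" "A \<subseteq> U" for A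
      proof -
        obtain B where B: "B \<in> P j" "A \<subseteq> B" using A chain_finer[of i j] step.hyps j by (auto simp: finer_def)
        moreover obtain x where "x \<in> A"
          using block_nonempty[OF partition A(1)] step.hyps j by auto
        ultimately have "B \<subseteq> U"
          using finer_below[OF partition[OF j] partition[OF step.prems(1)] _ step.prems(2) B(1), of x]
            chain_finer[of j "Suc j"] A step.prems(1) by auto
        with B show ?thesis by auto
      qed
      then show ?thesis by fastforce
    qed
    finally show ?thesis .
  qed
qed

lemma blocks_at_grow: "P m = {V} \<Longrightarrow> i \<le> m \<Longrightarrow> blocks_at (grow P m V) i = P i"
  using live_grow[of i m V] partition[of i] by (auto simp: blocks_at_def image_image partition_on_def)

lemma time_grow: "P m = {V} \<Longrightarrow> time (grow P m V) = m"
proof (cases m)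
  case (Suc k)
  assume top: "P m = {V}"
  have "V \<notin> P k"
    using partition_subset_eq[of V "{V}" "P k"] partition[of k] partition[of m] strict[of k m] top Suc
    by (auto simp: strictly_finer_def)
  with Suc show ?thesis by simp
qed simp

lemma time_attained:
  assumes "P m = {V}" "i \<le> m"
  shows "\<exists>s \<in># nodes (grow P m V). time s = i"
proof -
  have "\<exists>U \<in> P i. time (grow P i U) = i"
  proof (cases i)
    case 0
    have "P i \<noteq> {}" using partition[of m] partition[of i] assms by (auto simp: partition_on_def)
    then show ?thesis using 0 by auto
  next
    case (Suc k)
    have "\<not> P i \<subseteq> P k"
      using partition_subset_eq[OF partition partition, of i k] strict[of k i] Suc assms
      by (auto simp: strictly_finer_def)
    then show ?thesis using Suc by auto
  qed
  then obtain U where U: "U \<in> P i" "time (grow P i U) = i" by auto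
  moreover have "U \<subseteq> V" using U partition[OF assms(2)] by (auto simp: partition_on_def)
  ultimately have "grow P i U \<in> live (grow P m V) i" using live_grow[of i m V] assms by auto
  with U live_node show ?thesis by blast
qed

text \<open>
  The number of blocks drops at every step, which yields the bound \<open>card V - 1\<close> on the time of the
  root.
\<close>
lemma card_chain: "i \<le> m \<Longrightarrow> card (P i) + i \<le> card V"
proof (induction i)
  case 0
  then show ?case by (simp add: singletons card_image)
next
  case (Suc i)
  then show ?case
    using strictly_finer_card[OF finite_V partition partition strict, of i "Suc i"] by fastforce
qed

end

section \<open>Assembly trees and chains of partitions\<close>

definition chains_between :: "('b \<Rightarrow> 'b \<Rightarrow> bool) \<Rightarrow> 'b set \<Rightarrow> 'b \<Rightarrow> 'b \<Rightarrow> 'b list set" where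
  "chains_between R X a b = {xs. xs \<noteq> [] \<and> hd xs = a \<and> last xs = b \<and> set xs \<subseteq> X \<and> sorted_wrt R xs}"

text \<open>
  The connected gluing rule enters only through the property \<open>C\<close> of the vertex sets of internal
  nodes.
\<close>
definition gluing_trees :: "('a set \<Rightarrow> bool) \<Rightarrow> 'a set \<Rightarrow> 'a ltree set" where
  "gluing_trees C V = {t. assembled t \<and> vset t = V \<and> time t \<le> card V - 1 \<and>
     (\<forall>i \<le> time t. \<exists>s \<in># nodes t. time s = i) \<and> (\<forall>s \<in># internal_nodes t. C (vset s))}"

text \<open>
  The partition chain is the list \<open>[P 0, \<dots>, P m]\<close>, where \<open>m\<close> is the time of the root. Blocks of
  the partitions are vertex sets of nodes, internal ones or leaves; the latter are singletons, so
  \<open>C\<close> has to hold for singletons.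
\<close>
lemma bij_betw_chains_gluing_trees:
  assumes V: "finite V" "V \<noteq> {}" and C: "\<And>v. v \<in> V \<Longrightarrow> C {v}"
  shows "bij_betw (\<lambda>xs. grow ((!) xs) (length xs - 1) V)
    (chains_between strictly_finer {P. partition_on V P \<and> (\<forall>B \<in> P. C B)} ((\<lambda>v. {v}) ` V) {V})
    (gluing_trees C V)"
    (is "bij_betw ?grow ?chains _")
proof (rule bij_betw_byWitness[where f' = "\<lambda>t. map (blocks_at t) [0..<Suc (time t)]"])
  have chain: "partition_chain V ((!) xs) (length xs - 1)" and top: "xs ! (length xs - 1) = {V}"
    and conn: "\<And>i B. i < length xs \<Longrightarrow> B \<in> xs ! i \<Longrightarrow> C B" and ne: "xs \<noteq> []"
    if "xs \<in> ?chains" for xs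
  proof -
    have xs: "xs \<noteq> []" "hd xs = (\<lambda>v. {v}) ` V" "last xs = {V}" "sorted_wrt strictly_finer xs"
      using that by (simp_all add: chains_between_def)
    have blocks: "partition_on V (xs ! i) \<and> (\<forall>B \<in> xs ! i. C B)" if "i < length xs" for i
      using \<open>xs \<in> ?chains\<close> nth_mem[OF that] by (auto simp: chains_between_def)
    from xs have "xs ! 0 = (\<lambda>v. {v}) ` V" by (simp add: hd_conv_nth)
    moreover have "i < length xs" if "i \<le> length xs - 1" for i
      using that xs(1) by (cases xs) auto
    ultimately show "partition_chain V ((!) xs) (length xs - 1)"
      using V xs blocks by unfold_locales (auto simp: sorted_wrt_iff_nth_less)
    show "xs ! (length xs - 1) = {V}" using xs by (simp add: last_conv_nth)
    show "\<And>i B. i < length xs \<Longrightarrow> B \<in> xs ! i \<Longrightarrow> C B" "xs \<noteq> []" using xs blocks by auto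
  qed
  show "\<forall>xs\<in>?chains. map (blocks_at (?grow xs)) [0..<Suc (time (?grow xs))] = xs"
  proof
    fix xs assume xs: "xs \<in> ?chains"
    interpret partition_chain V "(!) xs" "length xs - 1" using chain[OF xs] .
    show "map (blocks_at (?grow xs)) [0..<Suc (time (?grow xs))] = xs"
      using time_grow[OF top[OF xs]] blocks_at_grow[OF top[OF xs]] ne[OF xs]
      by (intro nth_equalityI) (auto simp del: upt_Suc)
  qed
  show "?grow ` ?chains \<subseteq> gluing_trees C V"
  proof safe
    fix xs assume xs: "xs \<in> ?chains"
    interpret partition_chain V "(!) xs" "length xs - 1" using chain[OF xs] .
    let ?t = "?grow xs"
    have t: "assembled ?t" using assembled_grow[of "length xs - 1" V] top[OF xs] by simp
    have "C (vset s)" if "s \<in># internal_nodes ?t" for s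
    proof -
      have s: "s \<in># nodes ?t" using that by (simp add: internal_nodes_def)
      then have "time s \<le> length xs - 1"
        using assembled_node_time[OF t s] time_grow[OF top[OF xs]] by auto
      moreover from this have "vset s \<in> xs ! time s"
        using node_live[OF t s] blocks_at_grow[OF top[OF xs], of "time s"] by (auto simp: blocks_at_def)
      ultimately show ?thesis using conn[OF xs, of "time s" "vset s"] ne[OF xs] by (cases xs) auto
    qed
    moreover have "length xs - 1 \<le> card V - 1"
      using card_chain[of "length xs - 1"] top[OF xs] by simp
    ultimately show "?t \<in> gluing_trees C V"
      using t time_grow[OF top[OF xs]] time_attained[OF top[OF xs]] by (simp add: gluing_trees_def)
  qed
  show "\<forall>t\<in>gluing_trees C V. ?grow (map (blocks_at t) [0..<Suc (time t)]) = t"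
  proof
    fix t assume "t \<in> gluing_trees C V"
    then have t: "assembled t" "vset t = V" by (auto simp: gluing_trees_def)
    have "?grow (map (blocks_at t) [0..<Suc (time t)]) = grow (blocks_at t) (time t) (vset t)"
      using t(2) by (auto simp del: upt_Suc intro!: grow_cong)
    also have "\<dots> = t" by (rule grow_blocks_at[OF t(1)]) (simp add: live_eq[of t])
    finally show "?grow (map (blocks_at t) [0..<Suc (time t)]) = t" .
  qed
  show "(\<lambda>t. map (blocks_at t) [0..<Suc (time t)]) ` gluing_trees C V \<subseteq> ?chains"
  proof safe
    fix t assume "t \<in> gluing_trees C V"
    then have t: "assembled t" "vset t = V" and times: "\<And>i. i \<le> time t \<Longrightarrow> \<exists>s \<in># nodes t. time s = i"
      and C': "\<And>s. s \<in># internal_nodes t \<Longrightarrow> C (vset s)"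
      by (auto simp: gluing_trees_def)
    let ?xs = "map (blocks_at t) [0..<Suc (time t)]"
    have "C B" if "B \<in> blocks_at t i" for B i
    proof -
      obtain s where s: "s \<in># nodes t" "B = vset s"
        using \<open>B \<in> blocks_at t i\<close> live_node by (fastforce simp: blocks_at_def)
      show ?thesis
      proof (cases "is_leaf s")
        case True
        then have "is_singleton B" using assembled_leafD assembled_node[OF t(1) s(1)] s by blast
        moreover have "B \<subseteq> V" using assembled_node_vset[OF t(1) s(1)] s t by simp
        ultimately show ?thesis using C by (auto simp: is_singleton_def)
      qed (use C' s in \<open>auto simp: internal_nodes_def\<close>)
    qed
    moreover have "last ?xs = {V}" using blocks_at_time[of t] t by simp
    moreover have "hd ?xs = (\<lambda>v. {v}) ` V" using blocks_at_0[OF t(1)] t by (simp add: hd_map del: upt_Suc)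
    moreover have "sorted_wrt strictly_finer ?xs"
      using blocks_at_strictly_finer[OF t(1) times]
      by (auto simp: sorted_wrt_iff_nth_less simp del: upt_Suc)
    ultimately show "?xs \<in> ?chains"
      using blocks_at_partition[OF t(1)] t by (auto simp: chains_between_def simp del: upt_Suc)
  qed
qed

text \<open>
  The symmetrization in the definition of connectivity adds no arcs to a symmetric graph. The right
  side allows induction along paths inside \<open>U\<close>.
\<close>
lemma connected_induced_iff:
  fixes G :: "'a pair_pre_digraph"
  assumes "sym (parcs G)"
  shows "connected (with_proj G \<restriction> U) \<longleftrightarrow>
    U \<noteq> {} \<and> (\<forall>u \<in> U. \<forall>v \<in> U. (u, v) \<in> (parcs G \<inter> U \<times> U)\<^sup>*)"
proof -
  let ?r = "parcs G \<inter> U \<times> U"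
  have *: "arcs_ends (with_proj (mk_symmetric (with_proj G \<restriction> U))) = ?r"
    using assms by (auto simp: mk_symmetric_def arcs_ends_def arc_to_ends_def sym_def)
  have "(u, v) \<in> rtrancl_on U ?r \<longleftrightarrow> (u, v) \<in> ?r\<^sup>*" if "u \<in> U" for u v
  proof
    assume "(u, v) \<in> ?r\<^sup>*"
    then show "(u, v) \<in> rtrancl_on U ?r"
      using that by induction (auto intro: rtrancl_on_into_rtrancl_on)
  qed (rule rtrancl_on_rtranclI)
  then show ?thesis
    unfolding connected_def strongly_connected_def reachable_def *
    by (auto simp: mk_symmetric_def)
qed

text \<open>
  Chains of partitions into connected blocks are chains in the bond lattice of \<open>G\<close>.
\<close>
lemma num_assembly_trees_eq_chains:
  fixes G :: "'a pair_pre_digraph"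
  assumes G: "pair_graph G" and card: "card (pverts G) \<ge> 2"
  defines "conn \<equiv> \<lambda>U. connected (with_proj G \<restriction> U)"
  shows "a\<^sub>t\<^sup>C G = card (chains_between strictly_finer
    {P. partition_on (pverts G) P \<and> (\<forall>B \<in> P. conn B)} ((\<lambda>v. {v}) ` pverts G) {pverts G})"
proof -
  interpret pair_graph G by (rule G)
  have sym: "sym (parcs G)" using sym_arcs by (auto simp: symmetric_def)
  have "conn {v}" for v by (simp add: conn_def connected_induced_iff[OF sym])
  moreover have "finite (pverts G)" "pverts G \<noteq> {}"
    using card by (metis card.infinite not_numeral_le_zero) (use card in auto)
  moreover have "{t. time_dependent_assembly_tree G t \<and> connected_gluing_rule G t} = gluing_trees conn (pverts G)"
    using time_dependent_assembly_tree_iff[OF card]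
    by (auto simp: gluing_trees_def connected_gluing_rule_def conn_def)
  ultimately show ?thesis
    using bij_betw_same_card[OF bij_betw_chains_gluing_trees[of "pverts G" conn]]
    by (simp add: num_assembly_trees_def)
qed

section \<open>Connected partitions of a cycle and their cut edges\<close>

text \<open>
  The edge of the cycle that joins \<open>k\<close> and \<open>cyc_succ n k\<close> is represented by \<open>k\<close>, so that sets of
  edges are subsets of \<open>{1..n}\<close>, also for \<open>n = 2\<close>, where the only edge is counted twice.
\<close>
definition cyc_succ :: "nat \<Rightarrow> nat \<Rightarrow> nat" where
  "cyc_succ n k = k mod n + 1"

lemma cyc_succ_eq: "k \<in> {1..n} \<Longrightarrow> cyc_succ n k = (if k = n then 1 else k + 1)"
  by (auto simp: cyc_succ_def)

lemma cyc_succ_in: "k \<in> {1..n} \<Longrightarrow> cyc_succ n k \<in> {1..n}"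
  by (auto simp: cyc_succ_eq)

lemma parcs_cycle_graph:
  "parcs (cycle_graph n) = {(u, v). u \<in> {1..n} \<and> v \<in> {1..n} \<and> u \<noteq> v \<and> (v = cyc_succ n u \<or> u = cyc_succ n v)}"
  by (auto simp: cycle_graph_def cyc_succ_def)

abbreviation cycle_connected :: "nat \<Rightarrow> nat set \<Rightarrow> bool" where
  "cycle_connected n U \<equiv> connected (with_proj (cycle_graph n) \<restriction> U)"

lemma cycle_connected_iff:
  "cycle_connected n U \<longleftrightarrow>
    U \<noteq> {} \<and> (\<forall>u \<in> U. \<forall>v \<in> U. (u, v) \<in> (parcs (cycle_graph n) \<inter> U \<times> U)\<^sup>*)"
  by (rule connected_induced_iff) (auto simp: sym_def parcs_cycle_graph)

definition cut_edges :: "nat \<Rightarrow> nat set set \<Rightarrow> nat set" where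
  "cut_edges n P = {k \<in> {1..n}. \<not> (\<exists>B \<in> P. k \<in> B \<and> cyc_succ n k \<in> B)}"

lemma uncut_succ:
  assumes "partition_on {1..n} P" "B \<in> P" "k \<in> {1..n}" "k \<notin> cut_edges n P"
  shows "k \<in> B \<longleftrightarrow> cyc_succ n k \<in> B"
proof -
  from assms(3,4) obtain B' where B': "B' \<in> P" "k \<in> B'" "cyc_succ n k \<in> B'"
    by (auto simp: cut_edges_def)
  with block_eq[OF assms(1,2) B'(1)] show ?thesis by blast
qed

text \<open>
  If \<open>P\<close> cuts all edges that \<open>Q\<close> cuts, then a path inside a block \<open>A\<close> of \<open>P\<close> runs along edges that
  \<open>Q\<close> does not cut, so it stays in one block of \<open>Q\<close>. As \<open>A\<close> is connected, it lies in that block.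
\<close>
lemma finer_iff_cut_edges:
  assumes P: "partition_on {1..n} P" "\<And>B. B \<in> P \<Longrightarrow> cycle_connected n B"
    and Q: "partition_on {1..n} Q"
  shows "finer P Q \<longleftrightarrow> cut_edges n Q \<subseteq> cut_edges n P"
proof
  assume "finer P Q"
  then show "cut_edges n Q \<subseteq> cut_edges n P" by (fastforce simp: finer_def cut_edges_def)
next
  assume sub: "cut_edges n Q \<subseteq> cut_edges n P"
  show "finer P Q"
    unfolding finer_def
  proof
    fix A assume A: "A \<in> P"
    obtain u where u: "u \<in> A" "u \<in> {1..n}" using block_nonempty[OF P(1) A] by blast
    from Q u(2) obtain B where B: "B \<in> Q" "u \<in> B" by (rule block_obtain)
    have step: "k \<in> B \<longleftrightarrow> cyc_succ n k \<in> B" if k: "k \<in> A" "cyc_succ n k \<in> A" for k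
    proof (rule uncut_succ[OF Q B(1)])
      show "k \<in> {1..n}" using k A P(1) by (auto simp: partition_on_def)
      have "k \<notin> cut_edges n P" using k A by (auto simp: cut_edges_def)
      with sub show "k \<notin> cut_edges n Q" by auto
    qed
    have "v \<in> B" if "v \<in> A" for v
    proof -
      have "(u, v) \<in> (parcs (cycle_graph n) \<inter> A \<times> A)\<^sup>*"
        using P(2)[OF A] u that by (auto simp: cycle_connected_iff)
      then show ?thesis
        by induction (use B step in \<open>auto simp: parcs_cycle_graph\<close>)
    qed
    with B show "\<exists>B\<in>Q. A \<subseteq> B" by auto
  qed
qed

lemma uncut_interval:
  assumes P: "partition_on {1..n} P" and B: "B \<in> P" "i \<in> B"
    and "1 \<le> i" "i \<le> j" "j \<le> n" and uncut: "\<And>k. i \<le> k \<Longrightarrow> k < j \<Longrightarrow> k \<notin> cut_edges n P"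
  shows "j \<in> B"
  using \<open>i \<le> j\<close> \<open>j \<le> n\<close> uncut
proof (induction j rule: dec_induct)
  case (step k)
  then have "k \<in> B" "k \<in> {1..n}" using \<open>1 \<le> i\<close> by auto
  with uncut_succ[OF P B(1), of k] step show ?case by (auto simp: cyc_succ_eq)
qed (use B in simp)

text \<open>
  If \<open>k\<close> were the only cut edge, the way around the cycle from \<open>cyc_succ n k\<close> to \<open>k\<close> would avoid it
  and keep both ends in the same block. The way is composed of intervals not passing \<open>n\<close> and, for
  \<open>k \<noteq> n\<close>, of the edge from \<open>n\<close> to \<open>1\<close>.
\<close>
lemma card_cut_edges_neq_1:
  assumes P: "partition_on {1..n} P"
  shows "card (cut_edges n P) \<noteq> 1"
proof
  assume "card (cut_edges n P) = 1"
  then obtain k where k: "cut_edges n P = {k}" by (auto simp: card_1_singleton_iff)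
  then have kn: "k \<in> {1..n}" by (auto simp: cut_edges_def)
  from P cyc_succ_in[OF kn] obtain B where B: "B \<in> P" "cyc_succ n k \<in> B" by (rule block_obtain)
  have "k \<in> B"
  proof (cases "k = n")
    case True
    with B kn have "1 \<in> B" by (simp add: cyc_succ_eq)
    from uncut_interval[OF P B(1) this, of k] True kn k show ?thesis by auto
  next
    case False
    with B kn have "k + 1 \<in> B" by (simp add: cyc_succ_eq)
    from uncut_interval[OF P B(1) this, of n] False kn k have "n \<in> B" by auto
    then have "1 \<in> B" using uncut_succ[OF P B(1), of n] False kn k by (auto simp: cyc_succ_eq)
    from uncut_interval[OF P B(1) this, of k] kn k show ?thesis by auto
  qed
  with B kn have "k \<notin> cut_edges n P" by (auto simp: cut_edges_def)
  with k show False by simp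
qed

text \<open>
  The blocks are the components that remain after the edges in \<open>S\<close> have been removed. The endpoints
  of a removed edge \<open>k\<close> are in different components because there is a second removed edge \<open>l\<close>:
  the vertices between \<open>k\<close> and \<open>l\<close> can be left only through one of these two edges.
\<close>
lemma exists_partition_with_cut_edges:
  assumes n: "n \<ge> 2" and S: "S \<subseteq> {1..n}" "card S \<noteq> 1"
  shows "\<exists>P. partition_on {1..n} P \<and> (\<forall>B \<in> P. cycle_connected n B) \<and> cut_edges n P = S"
proof -
  define E where "E = {(u, v). u \<in> {1..n} \<and> v \<in> {1..n} \<and>
    (v = cyc_succ n u \<and> u \<notin> S \<or> u = cyc_succ n v \<and> v \<notin> S)}"
  define r where "r = E\<^sup>* \<inter> {1..n} \<times> {1..n}"
  have arcs: "E \<subseteq> parcs (cycle_graph n)"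
    using n by (auto simp: E_def parcs_cycle_graph cyc_succ_eq split: if_splits)
  have "sym E" by (auto simp: E_def sym_def)
  then have "sym (E\<^sup>*)" by (rule sym_rtrancl)
  then have equiv: "equiv {1..n} r"
    by (intro equivI) (auto simp: r_def refl_on_def sym_def trans_def)
  let ?P = "{1..n} // r"
  have P: "partition_on {1..n} ?P" using equiv by (rule partition_on_quotient)
  have same_block: "(u, v) \<in> r" if "B \<in> ?P" "u \<in> B" "v \<in> B" for B u v
    using quotient_eq_iff[OF equiv that(1,1,2,3)] by simp
  have closed: "v \<in> B" if "B \<in> ?P" "u \<in> B" "(u, v) \<in> r" for B u v
    using in_quotient_imp_closed[OF equiv that] .
  have "cycle_connected n B" if B: "B \<in> ?P" for B
    unfolding cycle_connected_iff
  proof (intro conjI ballI)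
    show "B \<noteq> {}" using block_nonempty[OF P B] by auto
    fix u v assume uv: "u \<in> B" "v \<in> B"
    from same_block[OF B uv] have "(u, v) \<in> E\<^sup>*" by (simp add: r_def)
    then have "(u, v) \<in> (parcs (cycle_graph n) \<inter> B \<times> B)\<^sup>* \<and> v \<in> B"
    proof induction
      case (step y z)
      from step.hyps(2) have "(y, z) \<in> r" by (auto simp: r_def E_def)
      with step.IH closed[OF B] have "z \<in> B" by blast
      with step arcs show ?case by (blast intro: rtrancl_into_rtrancl)
    qed (use uv in simp)
    then show "(u, v) \<in> (parcs (cycle_graph n) \<inter> B \<times> B)\<^sup>*" ..
  qed
  moreover have "cut_edges n ?P = S"
  proof (intro subset_antisym subsetI)
    fix k assume k: "k \<in> cut_edges n ?P"
    then have kn: "k \<in> {1..n}" by (simp add: cut_edges_def)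
    show "k \<in> S"
    proof (rule ccontr)
      assume "k \<notin> S"
      then have "(k, cyc_succ n k) \<in> r" using kn cyc_succ_in[OF kn] by (auto simp: r_def E_def)
      moreover from P kn obtain B where "B \<in> ?P" "k \<in> B" by (rule block_obtain)
      ultimately show False using closed k by (auto simp: cut_edges_def)
    qed
  next
    fix k assume k: "k \<in> S"
    then have kn: "k \<in> {1..n}" using S by auto
    have "S \<noteq> {k}" using S by auto
    with k obtain l where l: "l \<in> S" "l \<noteq> k" by auto
    then have ln: "l \<in> {1..n}" using S by auto
    \<comment> \<open>One of the two arcs into which the edges \<open>k\<close> and \<open>l\<close> divide the cycle.\<close>
    define A where "A = {min k l<..max k l}"
    have step: "u \<in> A \<longleftrightarrow> cyc_succ n u \<in> A" if "u \<in> {1..n}" "u \<notin> S" for u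
    proof -
      have "u \<noteq> k" "u \<noteq> l" using that k l by auto
      with that kn ln show ?thesis
        by (auto simp: A_def cyc_succ_eq min_def max_def split: if_splits)
    qed
    have edge: "u \<in> A \<longleftrightarrow> v \<in> A" if "(u, v) \<in> E" for u v
      using that step by (auto simp: E_def)
    have A: "u \<in> A \<longleftrightarrow> v \<in> A" if "(u, v) \<in> E\<^sup>*" for u v
      using that by (induction rule: rtrancl_induct) (auto simp: edge)
    have "\<not> (k \<in> A \<longleftrightarrow> cyc_succ n k \<in> A)"
      using kn ln l by (auto simp: A_def cyc_succ_eq min_def max_def split: if_splits)
    with A have "(k, cyc_succ n k) \<notin> r" by (auto simp: r_def)
    with same_block kn show "k \<in> cut_edges n ?P" by (auto simp: cut_edges_def)
  qed
  ultimately show ?thesis using P by blast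
qed

section \<open>Counting chains\<close>

lemma map_chains_between:
  assumes "f ` X \<subseteq> Y" "\<And>x y. x \<in> X \<Longrightarrow> y \<in> X \<Longrightarrow> R x y \<Longrightarrow> R' (f x) (f y)"
    and "xs \<in> chains_between R X a b"
  shows "map f xs \<in> chains_between R' Y (f a) (f b)"
  using assms
  by (fastforce simp: chains_between_def hd_map last_map sorted_wrt_map intro: sorted_wrt_mono_rel[of xs R])

lemma card_chains_between_iso:
  assumes f: "bij_betw f X Y" and R: "\<And>x y. x \<in> X \<Longrightarrow> y \<in> X \<Longrightarrow> R x y \<longleftrightarrow> R' (f x) (f y)"
    and ab: "a \<in> X" "b \<in> X"
  shows "card (chains_between R X a b) = card (chains_between R' Y (f a) (f b))"
proof (rule bij_betw_same_card)
  let ?g = "the_inv_into X f"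
  have inj: "inj_on f X" and onto: "f ` X = Y" using f by (auto simp: bij_betw_def)
  have g: "?g y \<in> X \<and> f (?g y) = y" if "y \<in> Y" for y
    using that inj onto by (metis f_the_inv_into_f the_inv_into_into subset_refl)
  show "bij_betw (map f) (chains_between R X a b) (chains_between R' Y (f a) (f b))"
  proof (rule bij_betw_byWitness[where f' = "map ?g"])
    show "\<forall>xs\<in>chains_between R X a b. map ?g (map f xs) = xs"
      using the_inv_into_f_f[OF inj] by (auto simp: chains_between_def intro!: map_idI)
    show "\<forall>ys\<in>chains_between R' Y (f a) (f b). map f (map ?g ys) = ys"
      using g by (auto simp: chains_between_def intro!: map_idI)
    show "map f ` chains_between R X a b \<subseteq> chains_between R' Y (f a) (f b)"
      using map_chains_between[of f X Y R R'] onto R by blast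
    have "map ?g ` chains_between R' Y (f a) (f b) \<subseteq> chains_between R X (?g (f a)) (?g (f b))"
      using map_chains_between[of ?g Y X R' R] g R by (metis image_subsetI)
    then show "map ?g ` chains_between R' Y (f a) (f b) \<subseteq> chains_between R X a b"
      using ab the_inv_into_f_f[OF inj] by simp
  qed
qed

text \<open>
  For \<open>n \<noteq> 1\<close>, the number of strictly decreasing chains of sets from an \<open>n\<close>-element set to \<open>{}\<close>
  without a set of size \<open>1\<close>.
\<close>
fun chain_count :: "nat \<Rightarrow> nat" where
  "chain_count n = (if n = 0 then 1 else \<Sum>j \<in> {..<n} - {1}. (n choose j) * chain_count j)"

declare chain_count.simps [simp del]

text \<open>
  A chain from a nonempty set \<open>A\<close> is \<open>A\<close> followed by a chain from a proper subset of \<open>A\<close>, and there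
  are \<open>card A choose j\<close> subsets of size \<open>j\<close>. The finite set \<open>N\<close> is kept fixed so that all chains
  live in the same family of sets.
\<close>
lemma card_set_chains:
  assumes N: "finite N" and A: "A \<subseteq> N" "card A \<noteq> 1"
  shows "finite (chains_between (\<lambda>A B. B \<subset> A) {S. S \<subseteq> N \<and> card S \<noteq> 1} A {})
    \<and> card (chains_between (\<lambda>A B. B \<subset> A) {S. S \<subseteq> N \<and> card S \<noteq> 1} A {}) = chain_count (card A)"
  using finite_subset[OF A(1) N] A
proof (induction A rule: finite_psubset_induct)
  case (psubset A)
  let ?ch = "\<lambda>A. chains_between (\<lambda>A B. B \<subset> A) {S. S \<subseteq> N \<and> card S \<noteq> 1} A {}"
  show ?case
  proof (cases "A = {}")
    case True
    have "xs = [{}]" if "xs \<in> ?ch {}" for xs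
      using that by (cases xs) (auto simp: chains_between_def)
    then have "?ch {} = {[{}]}" by (auto simp: chains_between_def)
    with True show ?thesis by (simp add: chain_count.simps[of 0])
  next
    case False
    \<comment> \<open>The possible second sets of a chain from \<open>A\<close>.\<close>
    define D where "D = {B. B \<subset> A \<and> card B \<noteq> 1}"
    have finD: "finite D" using psubset.hyps by (auto simp: D_def intro: finite_subset[of _ "Pow A"])
    have IH: "finite (?ch B)" "card (?ch B) = chain_count (card B)" if "B \<in> D" for B
      using psubset.IH[of B] psubset.prems that by (auto simp: D_def)
    have split: "?ch A = (\<Union>B\<in>D. (#) A ` ?ch B)"
    proof (intro subset_antisym subsetI)
      fix xs assume xs: "xs \<in> ?ch A"
      then obtain ys where ys: "xs = A # ys" by (cases xs) (auto simp: chains_between_def)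
      then have "ys \<noteq> []" using xs False by (auto simp: chains_between_def)
      with xs ys have "ys \<in> ?ch (hd ys)" "hd ys \<in> D"
        by (cases ys; auto simp: chains_between_def D_def)+
      with ys show "xs \<in> (\<Union>B\<in>D. (#) A ` ?ch B)" by blast
    next
      fix xs assume "xs \<in> (\<Union>B\<in>D. (#) A ` ?ch B)"
      then obtain B ys where B: "B \<in> D" "ys \<in> ?ch B" "xs = A # ys" by auto
      have "C \<subset> A" if "C \<in> set ys" for C
      proof -
        have "C = B \<or> C \<subset> B" using that B by (cases ys) (auto simp: chains_between_def)
        with B show ?thesis by (auto simp: D_def)
      qed
      with B psubset.prems show "xs \<in> ?ch A" by (auto simp: chains_between_def)
    qed
    have disj: "\<forall>B\<in>D. \<forall>B'\<in>D. B \<noteq> B' \<longrightarrow> (#) A ` ?ch B \<inter> (#) A ` ?ch B' = {}"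
      by (auto simp: chains_between_def)
    have fin: "finite (?ch A)" unfolding split using finD IH by blast
    have "card (?ch A) = (\<Sum>B\<in>D. card ((#) A ` ?ch B))"
      unfolding split using finD IH disj by (intro card_UN_disjoint) auto
    then have "card (?ch A) = (\<Sum>B\<in>D. chain_count (card B))"
      using IH by (simp add: card_image)
    also have "\<dots> = (\<Sum>j \<in> {..<card A} - {1}. \<Sum>B \<in> {B \<in> D. card B = j}. chain_count (card B))"
      using finD psubset.hyps by (intro sum.group[symmetric]) (auto simp: D_def intro: psubset_card_mono)
    also have "\<dots> = (\<Sum>j \<in> {..<card A} - {1}. (card A choose j) * chain_count j)"
    proof (rule sum.cong)
      fix j assume j: "j \<in> {..<card A} - {1}"
      then have "{B \<in> D. card B = j} = {B. B \<subseteq> A \<and> card B = j}" by (auto simp: D_def)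
      then show "(\<Sum>B \<in> {B \<in> D. card B = j}. chain_count (card B)) = (card A choose j) * chain_count j"
        using n_subsets[OF psubset.hyps, of j] by simp
    qed simp
    finally have "card (?ch A) = chain_count (card A)"
      using False psubset.hyps by (simp add: chain_count.simps[of "card A"])
    with fin show ?thesis by simp
  qed
qed

text \<open>
  Cut edges turn the bond lattice of the cycle upside down into the family of subsets of \<open>{1..n}\<close>
  that do not have size \<open>1\<close>.
\<close>
lemma num_assembly_trees_cycle_graph:
  assumes n: "n \<ge> 2"
  shows "a\<^sub>t\<^sup>C (cycle_graph n) = chain_count n"
proof -
  define V where "V = {1..n}"
  define X where "X = {P. partition_on V P \<and> (\<forall>B \<in> P. cycle_connected n B)}"
  define Y where "Y = {S. S \<subseteq> V \<and> card S \<noteq> 1}"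
  have verts: "pverts (cycle_graph n) = V" by (simp add: cycle_graph_def V_def)
  have card: "card V = n" by (simp add: V_def)
  have finer: "finer P Q \<longleftrightarrow> cut_edges n Q \<subseteq> cut_edges n P" if "P \<in> X" "Q \<in> X" for P Q
    using that by (intro finer_iff_cut_edges) (auto simp: X_def V_def)
  have eq: "P = Q" if "P \<in> X" "Q \<in> X" "cut_edges n P = cut_edges n Q" for P Q
    using that finer[of P Q] finer[of Q P] finer_antisym[of V P Q] by (simp add: X_def)
  have "cut_edges n ` X = Y"
  proof (intro subset_antisym subsetI)
    fix S assume "S \<in> cut_edges n ` X"
    then show "S \<in> Y"
      using card_cut_edges_neq_1 by (auto simp: X_def Y_def V_def) (auto simp: cut_edges_def)
  next
    fix S assume "S \<in> Y"
    with exists_partition_with_cut_edges[OF n, of S] show "S \<in> cut_edges n ` X"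
      by (auto simp: X_def Y_def V_def)
  qed
  with eq have bij: "bij_betw (cut_edges n) X Y" by (auto simp: bij_betw_def inj_on_def)
  have order: "strictly_finer P Q \<longleftrightarrow> cut_edges n Q \<subset> cut_edges n P" if "P \<in> X" "Q \<in> X" for P Q
    using finer[OF that] eq[OF that] by (auto simp: strictly_finer_def)
  have bot: "(\<lambda>v. {v}) ` V \<in> X"
    using partition_on_singletons[of V] by (auto simp: X_def cycle_connected_iff)
  have "connected (cycle_graph n)" using n by (intro connected_cycle_graph) simp
  moreover have "with_proj (cycle_graph n) \<restriction> V = with_proj (cycle_graph n)"
    by (auto simp: induce_subgraph_def cycle_graph_def V_def with_proj_def)
  ultimately have "cycle_connected n V" by simp
  then have top: "{V} \<in> X"
    using partition_on_space[of V] n by (auto simp: X_def V_def)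
  have "a\<^sub>t\<^sup>C (cycle_graph n) = card (chains_between strictly_finer X ((\<lambda>v. {v}) ` V) {V})"
    using num_assembly_trees_eq_chains[OF pair_graph_cycle_graph, of n] n by (simp add: verts card X_def)
  also have "\<dots> = card (chains_between (\<lambda>A B. B \<subset> A) Y (cut_edges n ((\<lambda>v. {v}) ` V)) (cut_edges n {V}))"
    by (rule card_chains_between_iso[OF bij _ bot top]) (rule order)
  also have "cut_edges n ((\<lambda>v. {v}) ` V) = V"
    using n by (auto simp: cut_edges_def V_def cyc_succ_eq split: if_splits)
  also have "cut_edges n {V} = {}"
    using cyc_succ_in by (auto simp: cut_edges_def V_def)
  also have "card (chains_between (\<lambda>A B. B \<subset> A) Y V {}) = chain_count n"
    using card_set_chains[of V V] n card by (simp add: Y_def V_def)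
  finally show ?thesis .
qed

theorem proposition4p5:
  shows "a\<^sub>t\<^sup>C (cycle_graph 1) = 1 \<and> a\<^sub>t\<^sup>C (cycle_graph 2) = 1 \<and>
    (\<forall>n\<ge>3. a\<^sub>t\<^sup>C (cycle_graph n) = 1 + (\<Sum>j = 2..n - 1. (n choose j) * a\<^sub>t\<^sup>C (cycle_graph j)))"
proof (intro conjI allI impI)
  have rec: "chain_count n = 1 + (\<Sum>j = 2..n - 1. (n choose j) * chain_count j)" if "n \<ge> 2" for n
  proof -
    have "{..<n} - {1} = insert 0 {2..n - 1}" using that by auto
    then show ?thesis using that by (subst chain_count.simps) (simp add: chain_count.simps[of 0])
  qed
  have "{t. time_dependent_assembly_tree (cycle_graph 1) t \<and> connected_gluing_rule (cycle_graph 1) t}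
      = {Node {1} 0 {#}}"
    by (auto simp: time_dependent_assembly_tree_def connected_gluing_rule_def cycle_graph_def
        internal_nodes_def is_leaf_def)
  then show "a\<^sub>t\<^sup>C (cycle_graph 1) = 1" by (simp add: num_assembly_trees_def)
  show "a\<^sub>t\<^sup>C (cycle_graph 2) = 1"
    using rec[of 2] by (simp add: num_assembly_trees_cycle_graph)
  show "a\<^sub>t\<^sup>C (cycle_graph n) = 1 + (\<Sum>j = 2..n - 1. (n choose j) * a\<^sub>t\<^sup>C (cycle_graph j))"
    if "n \<ge> 3" for n
    using rec[of n] that by (simp add: num_assembly_trees_cycle_graph)
qed

end
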